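(* Let $\Gamma=(V,T,\mathbf{s},\mathbf{r})$ be a network, and let $$I=\{[\alpha\beta^{-1}]\in Q_\Gamma:\ \alpha\in RP(\Gamma)\setminus RLP(\Gamma)\}\cup\{[0]\},$$ where the non-zero elements $[\alpha\beta^{-1}]$ are written in right normal form (that is, $\alpha\in RP(\Gamma)\setminus\{0\}$, $\beta\in RLP(\Gamma)$ and $\mathbf{r}(\alpha)=\mathbf{r}(\beta)$). Then $I$ is a proper ideal of $Q_\Gamma$. Further, $\rho_I=(I\times I)\cup 1_{Q_\Gamma}$ is an idempotent-separating congruence on $Q_\Gamma$.
   Context: A network $\Gamma=(V,T,\mathbf{s},\mathbf{r})$ consists of a set $V$ of vertices, a set $T$ of relations, and maps $\mathbf{s},\mathbf{r}:T\to\mathcal{P}(V)$ such that for every $t\in T$ the sets $\mathbf{s}(t)$ and $\mathbf{r}(t)$ are disjoint non-empty subsets of $V$; networks have finitely many or countably infinitely many vertices and relations. A vertex $v$ is identified with the singleton $\{v\}$. Put $T^0=\{A\subseteq V: A=\mathbf{s}(t)\text{ or }A=\mathbf{r}(t)\text{ for some }t\in T\}\cup V$, and set $\mathbf{s}(A)=A=\mathbf{r}(A)$ for $A\in T^0$. For each $t\in T$ let $t^{-1}$ be a formal symbol with $\mathbf{s}(t^{-1})=\mathbf{r}(t)$, $\mathbf{r}(t^{-1})=\mathbf{s}(t)$; put $A^{-1}=A$ for $A\in T^0$ and $T^{-1}=\{t^{-1}:t\in T\}$. The symbol sets $T$, $T^0$, $T^{-1}$, $\{0\}$ are pairwise disjoint.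 $Q_\Gamma$ is the semigroup generated by $X=T\cup T^0\cup T^{-1}\cup\{0\}$ subject to the relations: (NR1) $\mathbf{s}(t)t=t=t\mathbf{r}(t)$ for $t\in T\cup T^0\cup T^{-1}$; (NR2) $t_1t_2=0$ if $\mathbf{r}(t_1)\cap\mathbf{s}(t_2)=\emptyset$, for $t_1,t_2\in T\cup T^0\cup T^{-1}$; (NR3) $t_1^{-1}t_2=0$ if $t_1\neq t_2$, for $t_1,t_2\in T$; (NR4) $t^{-1}t=\mathbf{r}(t)$ for $t\in T$; (NR5) $t^{-1}A=0$ if $\mathbf{s}(t)\neq A$, for $t\in T$, $A\in T^0$; (NR6) $0x=0=x0$ for all $x\in X$. $[w]$ denotes the class in $Q_\Gamma$ of a word $w$. A non-zero path is a finite non-empty sequence $\alpha=t_1\cdots t_n$ with $t_i\in T\cup T^0$ and $\mathbf{r}(t_i)\cap\mathbf{s}(t_{i+1})\neq\emptyset$ for $1\le i<n$; $\mathbf{s}(\alpha)=\mathbf{s}(t_1)$, $\mathbf{r}(\alpha)=\mathbf{r}(t_n)$, $\alpha^{-1}=t_n^{-1}\cdots t_1^{-1}$. It is linear if $\mathbf{r}(t_i)=\mathbf{s}(t_{i+1})$ for $1\le i<n$, and reduced if $t_i\neq\mathbf{s}(t_{i+1})$ and $t_{i+1}\neq\mathbf{r}(t_i)$ for $1\le i<n$. $RP(\Gamma)$ is the set of reduced paths together with $0$, and $RLP(\Gamma)$ is the set of non-zero reduced linear paths. Every non-zero element of $Q_\Gamma$ has a unique right normal form: it is $[\alpha\beta^{-1}]$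 for a unique pair $\alpha\in RP(\Gamma)\setminus\{0\}$, $\beta\in RLP(\Gamma)$ with $\mathbf{r}(\alpha)=\mathbf{r}(\beta)$. $1_{Q_\Gamma}$ is the identity relation on $Q_\Gamma$. A congruence is idempotent-separating if no two distinct idempotents are related by it. *)

theory Defs
  imports Main "HOL-Library.Countable_Set"
begin

section \<open>Semigroups with an explicit carrier\<close>

definition semigroup_on :: "'a set \<Rightarrow> ('a \<Rightarrow> 'a \<Rightarrow> 'a) \<Rightarrow> bool" where
  "semigroup_on S m \<longleftrightarrow>
     (\<forall>x\<in>S. \<forall>y\<in>S. m x y \<in> S) \<and>
     (\<forall>x\<in>S. \<forall>y\<in>S. \<forall>z\<in>S. m (m x y) z = m x (m y z))"

definition semigroup_ideal :: "'a set \<Rightarrow> ('a \<Rightarrow> 'a \<Rightarrow> 'a) \<Rightarrow> 'a set \<Rightarrow> bool" where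
  "semigroup_ideal S m I \<longleftrightarrow>
     I \<noteq> {} \<and> I \<subseteq> S \<and> (\<forall>a\<in>I. \<forall>x\<in>S. m x a \<in> I \<and> m a x \<in> I)"

text \<open>Proper means different from the whole semigroup; the zero ideal is allowed.\<close>

definition proper_semigroup_ideal :: "'a set \<Rightarrow> ('a \<Rightarrow> 'a \<Rightarrow> 'a) \<Rightarrow> 'a set \<Rightarrow> bool" where
  "proper_semigroup_ideal S m I \<longleftrightarrow> semigroup_ideal S m I \<and> I \<noteq> S"

definition semigroup_congruence :: "'a set \<Rightarrow> ('a \<Rightarrow> 'a \<Rightarrow> 'a) \<Rightarrow> ('a \<times> 'a) set \<Rightarrow> bool" where
  "semigroup_congruence S m \<rho> \<longleftrightarrow>
     equiv S \<rho> \<and>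
     (\<forall>(a, b)\<in>\<rho>. \<forall>c\<in>S. (m c a, m c b) \<in> \<rho> \<and> (m a c, m b c) \<in> \<rho>)"

definition idempotent_separating :: "'a set \<Rightarrow> ('a \<Rightarrow> 'a \<Rightarrow> 'a) \<Rightarrow> ('a \<times> 'a) set \<Rightarrow> bool" where
  "idempotent_separating S m \<rho> \<longleftrightarrow>
     (\<forall>e\<in>S. \<forall>f\<in>S. m e e = e \<and> m f f = f \<and> (e, f) \<in> \<rho> \<longrightarrow> e = f)"


section \<open>Semigroup presentations\<close>

definition nonempty_words :: "'g set \<Rightarrow> 'g list set" where
  "nonempty_words X = lists X - {[]}"

text \<open>The congruence on the free semigroup over \<open>X\<close> generated by \<open>R\<close>.\<close>

inductive_set pres_cong :: "'g set \<Rightarrow> ('g list \<times> 'g list) set \<Rightarrow> ('g list \<times> 'g list) set"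
  for X :: "'g set" and R :: "('g list \<times> 'g list) set" where
  refl: "w \<in> nonempty_words X \<Longrightarrow> (w, w) \<in> pres_cong X R"
| sym: "(u, v) \<in> pres_cong X R \<Longrightarrow> (v, u) \<in> pres_cong X R"
| trans: "(u, v) \<in> pres_cong X R \<Longrightarrow> (v, w) \<in> pres_cong X R \<Longrightarrow> (u, w) \<in> pres_cong X R"
| step: "(u, v) \<in> R \<Longrightarrow> u \<in> nonempty_words X \<Longrightarrow> v \<in> nonempty_words X \<Longrightarrow>
    x \<in> lists X \<Longrightarrow> y \<in> lists X \<Longrightarrow> (x @ u @ y, x @ v @ y) \<in> pres_cong X R"

definition pres_carrier :: "'g set \<Rightarrow> ('g list \<times> 'g list) set \<Rightarrow> 'g list set set" where
  "pres_carrier X R = nonempty_words X // pres_cong X R"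

definition pres_class :: "'g set \<Rightarrow> ('g list \<times> 'g list) set \<Rightarrow> 'g list \<Rightarrow> 'g list set" where
  "pres_class X R w = pres_cong X R `` {w}"

definition pres_mult ::
  "'g set \<Rightarrow> ('g list \<times> 'g list) set \<Rightarrow> 'g list set \<Rightarrow> 'g list set \<Rightarrow> 'g list set" where
  "pres_mult X R C D = (\<Union>u\<in>C. \<Union>v\<in>D. pres_class X R (u @ v))"

lemma pres_cong_subset:
  "pres_cong X R \<subseteq> nonempty_words X \<times> nonempty_words X"
proof -
  have "u \<in> nonempty_words X \<and> v \<in> nonempty_words X" if "(u, v) \<in> pres_cong X R" for u v
    using that by induction (auto simp: nonempty_words_def)
  then show ?thesis by auto
qed

lemma equiv_pres_cong: "equiv (nonempty_words X) (pres_cong X R)"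
  by (intro equivI pres_cong_subset refl_onI symI transI)
    (auto intro: pres_cong.refl pres_cong.sym pres_cong.trans)

lemma pres_cong_context:
  assumes "(u, v) \<in> pres_cong X R" "x \<in> lists X" "y \<in> lists X"
  shows "(x @ u @ y, x @ v @ y) \<in> pres_cong X R"
  using assms
proof (induction)
  case (step u v p q)
  then have "((x @ p) @ u @ (q @ y), (x @ p) @ v @ (q @ y)) \<in> pres_cong X R"
    by (intro pres_cong.step) auto
  then show ?case by simp
qed (auto intro: pres_cong.intros simp: nonempty_words_def)

lemma pres_mult_congruent2:
  "congruent2 (pres_cong X R) (pres_cong X R) (\<lambda>u v. pres_class X R (u @ v))"
proof (rule congruent2I'; unfold pres_class_def, rule equiv_class_eq[OF equiv_pres_cong])
  fix u u' v v'
  assume *: "(u, u') \<in> pres_cong X R" "(v, v') \<in> pres_cong X R"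
  then have "u' \<in> lists X" "v \<in> lists X"
    using pres_cong_subset[of X R] by (auto simp: nonempty_words_def)
  with pres_cong_context[OF *(1), of "[]" v] pres_cong_context[OF *(2), of u' "[]"]
  show "(u @ v, u' @ v') \<in> pres_cong X R"
    by (auto intro: pres_cong.trans)
qed

lemma pres_mult_class:
  assumes "u \<in> nonempty_words X" "v \<in> nonempty_words X"
  shows "pres_mult X R (pres_class X R u) (pres_class X R v) = pres_class X R (u @ v)"
  using UN_equiv_class2[OF equiv_pres_cong equiv_pres_cong pres_mult_congruent2 assms]
  unfolding pres_mult_def pres_class_def .

lemma semigroup_on_pres: "semigroup_on (pres_carrier X R) (pres_mult X R)"
proof -
  have [simp]: "u @ v \<in> nonempty_words X"
    if "u \<in> nonempty_words X" "v \<in> nonempty_words X" for u v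
    using that by (auto simp: nonempty_words_def)
  have "pres_carrier X R = pres_class X R ` nonempty_words X"
    by (auto simp: pres_carrier_def pres_class_def quotient_def)
  then show ?thesis
    by (auto simp: semigroup_on_def pres_mult_class)
qed


section \<open>Networks\<close>

record ('v, 't) network_data =
  verts :: "'v set"
  rels :: "'t set"
  src :: "'t \<Rightarrow> 'v set"
  rng :: "'t \<Rightarrow> 'v set"

definition network :: "('v, 't) network_data \<Rightarrow> bool" where
  "network \<Gamma> \<longleftrightarrow>
     countable (verts \<Gamma>) \<and> countable (rels \<Gamma>) \<and>
     (\<forall>t\<in>rels \<Gamma>. src \<Gamma> t \<subseteq> verts \<Gamma> \<and> rng \<Gamma> t \<subseteq> verts \<Gamma> \<and>
        src \<Gamma> t \<noteq> {} \<and> rng \<Gamma> t \<noteq> {} \<and> src \<Gamma> t \<inter> rng \<Gamma> t = {})"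

text \<open>The set \<open>T\<^sup>0\<close>; a vertex \<open>v\<close> is identified with \<open>{v}\<close>.\<close>

definition vsets :: "('v, 't) network_data \<Rightarrow> 'v set set" where
  "vsets \<Gamma> = {A. \<exists>t\<in>rels \<Gamma>. A = src \<Gamma> t \<or> A = rng \<Gamma> t} \<union> (\<lambda>v. {v}) ` verts \<Gamma>"

text \<open>The constructors keep \<open>T\<close>, \<open>T\<^sup>-\<^sup>1\<close>, \<open>T\<^sup>0\<close> and \<open>{0}\<close> disjoint.\<close>

datatype ('v, 't) symb = Rel 't | InvRel 't | VSet "'v set" | Zero

text \<open>The value of \<open>ssrc\<close> and \<open>srng\<close> at \<^term>\<open>Zero\<close> is a dummy that is never used.\<close>

fun ssrc :: "('v, 't) network_data \<Rightarrow> ('v, 't) symb \<Rightarrow> 'v set" where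
  "ssrc \<Gamma> (Rel t) = src \<Gamma> t"
| "ssrc \<Gamma> (InvRel t) = rng \<Gamma> t"
| "ssrc \<Gamma> (VSet A) = A"
| "ssrc \<Gamma> Zero = {}"

fun srng :: "('v, 't) network_data \<Rightarrow> ('v, 't) symb \<Rightarrow> 'v set" where
  "srng \<Gamma> (Rel t) = rng \<Gamma> t"
| "srng \<Gamma> (InvRel t) = src \<Gamma> t"
| "srng \<Gamma> (VSet A) = A"
| "srng \<Gamma> Zero = {}"

fun sinv :: "('v, 't) symb \<Rightarrow> ('v, 't) symb" where
  "sinv (Rel t) = InvRel t"
| "sinv (InvRel t) = Rel t"
| "sinv (VSet A) = VSet A"
| "sinv Zero = Zero"

definition nonzero_symbs :: "('v, 't) network_data \<Rightarrow> ('v, 't) symb set" where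
  "nonzero_symbs \<Gamma> = Rel ` rels \<Gamma> \<union> VSet ` vsets \<Gamma> \<union> InvRel ` rels \<Gamma>"

definition symbs :: "('v, 't) network_data \<Rightarrow> ('v, 't) symb set" where
  "symbs \<Gamma> = nonzero_symbs \<Gamma> \<union> {Zero}"

inductive_set NR ::
  "('v, 't) network_data \<Rightarrow> (('v, 't) symb list \<times> ('v, 't) symb list) set"
  for \<Gamma> :: "('v, 't) network_data" where
  NR1_src: "x \<in> nonzero_symbs \<Gamma> \<Longrightarrow> ([VSet (ssrc \<Gamma> x), x], [x]) \<in> NR \<Gamma>"
| NR1_rng: "x \<in> nonzero_symbs \<Gamma> \<Longrightarrow> ([x, VSet (srng \<Gamma> x)], [x]) \<in> NR \<Gamma>"
| NR2: "x \<in> nonzero_symbs \<Gamma> \<Longrightarrow> y \<in> nonzero_symbs \<Gamma> \<Longrightarrow> srng \<Gamma> x \<inter> ssrc \<Gamma> y = {} \<Longrightarrow>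
    ([x, y], [Zero]) \<in> NR \<Gamma>"
| NR3: "t \<in> rels \<Gamma> \<Longrightarrow> t' \<in> rels \<Gamma> \<Longrightarrow> t \<noteq> t' \<Longrightarrow> ([InvRel t, Rel t'], [Zero]) \<in> NR \<Gamma>"
| NR4: "t \<in> rels \<Gamma> \<Longrightarrow> ([InvRel t, Rel t], [VSet (rng \<Gamma> t)]) \<in> NR \<Gamma>"
| NR5: "t \<in> rels \<Gamma> \<Longrightarrow> A \<in> vsets \<Gamma> \<Longrightarrow> src \<Gamma> t \<noteq> A \<Longrightarrow> ([InvRel t, VSet A], [Zero]) \<in> NR \<Gamma>"
| NR6_left: "x \<in> symbs \<Gamma> \<Longrightarrow> ([Zero, x], [Zero]) \<in> NR \<Gamma>"
| NR6_right: "x \<in> symbs \<Gamma> \<Longrightarrow> ([x, Zero], [Zero]) \<in> NR \<Gamma>"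

text \<open>The semigroup \<open>Q\<^sub>\<Gamma>\<close>: carrier, multiplication, and class of a word.\<close>

definition Q :: "('v, 't) network_data \<Rightarrow> ('v, 't) symb list set set" where
  "Q \<Gamma> = pres_carrier (symbs \<Gamma>) (NR \<Gamma>)"

definition Qmult :: "('v, 't) network_data \<Rightarrow>
    ('v, 't) symb list set \<Rightarrow> ('v, 't) symb list set \<Rightarrow> ('v, 't) symb list set" where
  "Qmult \<Gamma> = pres_mult (symbs \<Gamma>) (NR \<Gamma>)"

definition Qclass :: "('v, 't) network_data \<Rightarrow> ('v, 't) symb list \<Rightarrow> ('v, 't) symb list set" where
  "Qclass \<Gamma> = pres_class (symbs \<Gamma>) (NR \<Gamma>)"

lemma semigroup_on_Q: "semigroup_on (Q \<Gamma>) (Qmult \<Gamma>)"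
  unfolding Q_def Qmult_def by (rule semigroup_on_pres)


section \<open>Paths\<close>

definition nonzero_path :: "('v, 't) network_data \<Rightarrow> ('v, 't) symb list \<Rightarrow> bool" where
  "nonzero_path \<Gamma> \<alpha> \<longleftrightarrow>
     \<alpha> \<noteq> [] \<and> set \<alpha> \<subseteq> Rel ` rels \<Gamma> \<union> VSet ` vsets \<Gamma> \<and>
     successively (\<lambda>x y. srng \<Gamma> x \<inter> ssrc \<Gamma> y \<noteq> {}) \<alpha>"

definition linear_path :: "('v, 't) network_data \<Rightarrow> ('v, 't) symb list \<Rightarrow> bool" where
  "linear_path \<Gamma> \<alpha> \<longleftrightarrow> nonzero_path \<Gamma> \<alpha> \<and> successively (\<lambda>x y. srng \<Gamma> x = ssrc \<Gamma> y) \<alpha>"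

definition reduced_path :: "('v, 't) network_data \<Rightarrow> ('v, 't) symb list \<Rightarrow> bool" where
  "reduced_path \<Gamma> \<alpha> \<longleftrightarrow> nonzero_path \<Gamma> \<alpha> \<and>
     successively (\<lambda>x y. x \<noteq> VSet (ssrc \<Gamma> y) \<and> y \<noteq> VSet (srng \<Gamma> x)) \<alpha>"

definition path_rng :: "('v, 't) network_data \<Rightarrow> ('v, 't) symb list \<Rightarrow> 'v set" where
  "path_rng \<Gamma> \<alpha> = srng \<Gamma> (last \<alpha>)"

definition path_inv :: "('v, 't) symb list \<Rightarrow> ('v, 't) symb list" where
  "path_inv \<alpha> = map sinv (rev \<alpha>)"

text \<open>The zero path in \<open>RP(\<Gamma>)\<close> is the one-letter word \<open>[Zero]\<close>.\<close>

definition RP :: "('v, 't) network_data \<Rightarrow> ('v, 't) symb list set" where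
  "RP \<Gamma> = {\<alpha>. reduced_path \<Gamma> \<alpha>} \<union> {[Zero]}"

definition RLP :: "('v, 't) network_data \<Rightarrow> ('v, 't) symb list set" where
  "RLP \<Gamma> = {\<alpha>. reduced_path \<Gamma> \<alpha> \<and> linear_path \<Gamma> \<alpha>}"

end

theory Submission
  imports Defs
begin

text \<open>
  The ideal \<open>I\<close> has a description by arbitrary words in place of normal forms: it consists of the
  classes of words that contain \<open>0\<close> or a \<^emph>\<open>broken\<close> junction, that is, adjacent letters \<open>x y\<close> with
  \<open>\<r>(x) \<noteq> \<s>(y)\<close>.  A word keeps its broken junction when it is extended on either side, so with this
  description the ideal property is immediate.  That the two descriptions agree is shown by
  bringing a word into right normal form letter by letter from the right
  (\<open>normal_form_Cons\<close>, \<open>normal_form\<close>): as long as the result is not zero, a break of the word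
  survives as a break of the path \<open>\<alpha>\<close>.

  That elements of \<open>Q\<^sub>\<Gamma>\<close> differ (some element lies outside \<open>I\<close>, certain elements are not
  idempotent) is read off from an action of \<open>Q\<^sub>\<Gamma>\<close> by partial maps.  Left multiplication on paths is coarsened to the triples \<open>(C, u, n)\<close>, where \<open>C\<close> is
  the source of the path, \<open>u\<close> its linear initial segment and \<open>n\<close> the number of its breaks.  No
  letter ever lowers \<open>n\<close>, and a broken word raises \<open>n\<close> strictly on every triple that it does not
  annihilate (\<open>broken_raises\<close>).

  Now a vertex \<open>v\<close> fixes the triple \<open>({v}, [], 0)\<close>, so it lies outside \<open>I\<close> and \<open>I\<close> is proper.
  An idempotent fixes every point of its image; an idempotent in \<open>I\<close> also raises \<open>n\<close> on its image,
  so the image is empty.  But \<open>\<alpha> \<beta>\<^sup>-\<^sup>1\<close> does not annihilate the triple that belongs to the path \<open>\<beta>\<close>.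
  Hence \<open>0\<close> is the only idempotent in \<open>I\<close>, and the Rees congruence of \<open>I\<close> separates idempotents.
\<close>

section \<open>Rees congruences\<close>

lemma Rees_congruence:
  assumes "semigroup_on S m" and I: "semigroup_ideal S m I"
  shows "semigroup_congruence S m (I \<times> I \<union> Id_on S)"
proof -
  have "I \<subseteq> S"
    using I by (simp add: semigroup_ideal_def)
  then have "equiv S (I \<times> I \<union> Id_on S)"
    by (auto intro!: equivI refl_onI symI transI)
  then show ?thesis
    using assms by (auto simp: semigroup_congruence_def semigroup_ideal_def semigroup_on_def)
qed

section \<open>Computing in \<open>Q\<^sub>\<Gamma>\<close>\<close>

lemma symbs_simps [simp]:
  "Rel t \<in> symbs \<Gamma> \<longleftrightarrow> t \<in> rels \<Gamma>"
  "InvRel t \<in> symbs \<Gamma> \<longleftrightarrow> t \<in> rels \<Gamma>"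
  "VSet A \<in> symbs \<Gamma> \<longleftrightarrow> A \<in> vsets \<Gamma>"
  "Zero \<in> symbs \<Gamma>"
  by (auto simp: symbs_def nonzero_symbs_def)

lemma nonzero_symbs_simps [simp]:
  "Rel t \<in> nonzero_symbs \<Gamma> \<longleftrightarrow> t \<in> rels \<Gamma>"
  "InvRel t \<in> nonzero_symbs \<Gamma> \<longleftrightarrow> t \<in> rels \<Gamma>"
  "VSet A \<in> nonzero_symbs \<Gamma> \<longleftrightarrow> A \<in> vsets \<Gamma>"
  "Zero \<notin> nonzero_symbs \<Gamma>"
  by (auto simp: nonzero_symbs_def)

lemma vsets_src_rng [simp]:
  "t \<in> rels \<Gamma> \<Longrightarrow> src \<Gamma> t \<in> vsets \<Gamma>"
  "t \<in> rels \<Gamma> \<Longrightarrow> rng \<Gamma> t \<in> vsets \<Gamma>"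
  by (auto simp: vsets_def)

lemma nonzero_symbs_cases:
  assumes "x \<in> nonzero_symbs \<Gamma>"
  obtains (positive) "x \<in> Rel ` rels \<Gamma> \<union> VSet ` vsets \<Gamma>" | (inverse) t where "x = InvRel t" "t \<in> rels \<Gamma>"
  using assms by (auto simp: nonzero_symbs_def)

lemma nonzero_symbs_src_rng:
  "x \<in> nonzero_symbs \<Gamma> \<Longrightarrow> ssrc \<Gamma> x \<in> vsets \<Gamma>"
  "x \<in> nonzero_symbs \<Gamma> \<Longrightarrow> srng \<Gamma> x \<in> vsets \<Gamma>"
  by (auto simp: nonzero_symbs_def)

lemma nonzero_symbs_imp_symbs: "x \<in> nonzero_symbs \<Gamma> \<Longrightarrow> x \<in> symbs \<Gamma>"
  by (simp add: symbs_def)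

lemma NR_words:
  assumes "(u, v) \<in> NR \<Gamma>"
  shows "u \<in> nonempty_words (symbs \<Gamma>)" "v \<in> nonempty_words (symbs \<Gamma>)"
  using assms
  by (induction; auto simp: nonempty_words_def nonzero_symbs_imp_symbs nonzero_symbs_src_rng)+

abbreviation cong_word ::
  "('v, 't) symb list \<Rightarrow> ('v, 't) network_data \<Rightarrow> ('v, 't) symb list \<Rightarrow> bool"
  ("(_ \<approx>\<^bsub>_\<^esub> _)" [51, 0, 51] 50)
  where "u \<approx>\<^bsub>\<Gamma>\<^esub> v \<equiv> (u, v) \<in> pres_cong (symbs \<Gamma>) (NR \<Gamma>)"

lemma cong_NR:
  assumes "(u, v) \<in> NR \<Gamma>" "p \<in> lists (symbs \<Gamma>)" "q \<in> lists (symbs \<Gamma>)"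
  shows "p @ u @ q \<approx>\<^bsub>\<Gamma>\<^esub> p @ v @ q"
  using assms by (intro pres_cong.step NR_words)

lemmas cong_NR_front = cong_NR[where p = "[]", simplified]

lemmas cong_trans [trans] = pres_cong.trans

lemma Zero_absorbs_right:
  "q \<in> lists (symbs \<Gamma>) \<Longrightarrow> Zero # q \<approx>\<^bsub>\<Gamma>\<^esub> [Zero]"
proof (induction q)
  case Nil
  show ?case by (rule pres_cong.refl) (simp add: nonempty_words_def)
next
  case (Cons x q)
  then have "Zero # x # q \<approx>\<^bsub>\<Gamma>\<^esub> Zero # q"
    using cong_NR_front[OF NR6_left, of x \<Gamma> q] by simp
  also have "Zero # q \<approx>\<^bsub>\<Gamma>\<^esub> [Zero]"
    using Cons by simp
  finally show ?case .
qed

lemma Zero_absorbs_left: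
  "p \<in> lists (symbs \<Gamma>) \<Longrightarrow> p @ [Zero] \<approx>\<^bsub>\<Gamma>\<^esub> [Zero]"
proof (induction p)
  case Nil
  show ?case by (simp add: pres_cong.refl nonempty_words_def)
next
  case (Cons x p)
  then have "[x] @ (p @ [Zero]) @ [] \<approx>\<^bsub>\<Gamma>\<^esub> [x] @ [Zero] @ []"
    by (intro pres_cong_context) auto
  also have "[x] @ [Zero] @ [] \<approx>\<^bsub>\<Gamma>\<^esub> [Zero]"
    using Cons cong_NR_front[OF NR6_right, of x \<Gamma> "[]"] by simp
  finally show ?case by simp
qed

lemma cong_Zero_front:
  assumes "(u, [Zero]) \<in> NR \<Gamma>" "q \<in> lists (symbs \<Gamma>)"
  shows "u @ q \<approx>\<^bsub>\<Gamma>\<^esub> [Zero]"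
  using cong_NR_front[OF assms] Zero_absorbs_right[OF assms(2)] by (auto intro: cong_trans)

lemma Qclass_eq_iff:
  assumes "u \<in> nonempty_words (symbs \<Gamma>)" "v \<in> nonempty_words (symbs \<Gamma>)"
  shows "Qclass \<Gamma> u = Qclass \<Gamma> v \<longleftrightarrow> u \<approx>\<^bsub>\<Gamma>\<^esub> v"
  using assms by (simp add: Qclass_def pres_class_def eq_equiv_class_iff[OF equiv_pres_cong])

lemma Q_eq_classes: "Q \<Gamma> = Qclass \<Gamma> ` nonempty_words (symbs \<Gamma>)"
  by (auto simp: Q_def Qclass_def pres_carrier_def pres_class_def quotient_def)

lemma Qmult_class:
  assumes "u \<in> nonempty_words (symbs \<Gamma>)" "v \<in> nonempty_words (symbs \<Gamma>)"
  shows "Qmult \<Gamma> (Qclass \<Gamma> u) (Qclass \<Gamma> v) = Qclass \<Gamma> (u @ v)"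
  using assms by (simp add: Qmult_def Qclass_def pres_mult_class)

section \<open>Broken words and right normal forms\<close>

definition broken :: "('v, 't) network_data \<Rightarrow> ('v, 't) symb list \<Rightarrow> bool" where
  "broken \<Gamma> w \<longleftrightarrow> Zero \<in> set w \<or> \<not> successively (\<lambda>x y. srng \<Gamma> x = ssrc \<Gamma> y) w"

lemma broken_append: "broken \<Gamma> u \<or> broken \<Gamma> v \<Longrightarrow> broken \<Gamma> (u @ v)"
  by (auto simp: broken_def successively_append_iff)

lemma nonzero_path_words:
  assumes "nonzero_path \<Gamma> \<alpha>"
  shows "\<alpha> \<in> nonempty_words (symbs \<Gamma>)"
  using assms by (auto simp: nonzero_path_def nonempty_words_def)

lemma path_inv_words:
  assumes "nonzero_path \<Gamma> \<beta>"
  shows "path_inv \<beta> \<in> lists (symbs \<Gamma>)"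
  using assms by (fastforce simp: nonzero_path_def path_inv_def)

definition right_normal_form ::
  "('v, 't) network_data \<Rightarrow> ('v, 't) symb list \<Rightarrow> ('v, 't) symb list \<Rightarrow> bool" where
  "right_normal_form \<Gamma> \<alpha> \<beta> \<longleftrightarrow>
     reduced_path \<Gamma> \<alpha> \<and> reduced_path \<Gamma> \<beta> \<and> linear_path \<Gamma> \<beta> \<and> path_rng \<Gamma> \<alpha> = path_rng \<Gamma> \<beta>"

lemma right_normal_form_words:
  assumes "right_normal_form \<Gamma> \<alpha> \<beta>"
  shows "\<alpha> @ path_inv \<beta> \<in> nonempty_words (symbs \<Gamma>)"
  using assms nonzero_path_words[of \<Gamma> \<alpha>] path_inv_words[of \<Gamma> \<beta>]
  by (auto simp: right_normal_form_def reduced_path_def nonempty_words_def)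

lemma right_normal_form_broken:
  assumes "right_normal_form \<Gamma> \<alpha> \<beta>" "\<not> linear_path \<Gamma> \<alpha>"
  shows "broken \<Gamma> (\<alpha> @ path_inv \<beta>)"
  using assms by (intro broken_append)
    (auto simp: broken_def linear_path_def right_normal_form_def reduced_path_def)

text \<open>
  Prepending \<open>x\<close> to a reduced path can violate reducedness at the new junction only, and
  dropping one vertex set there repairs it: the dropped set equals the range of the letter before
  it or the source of the letter after it, so that the breaks of the path stay as they are.
\<close>

lemma reduced_path_Cons:
  assumes \<alpha>: "reduced_path \<Gamma> \<alpha>" and x: "x \<in> Rel ` rels \<Gamma> \<union> VSet ` vsets \<Gamma>"
    and meet: "srng \<Gamma> x \<inter> ssrc \<Gamma> (hd \<alpha>) \<noteq> {}"
  obtains \<alpha>' where "reduced_path \<Gamma> \<alpha>'" "x # \<alpha> \<approx>\<^bsub>\<Gamma>\<^esub> \<alpha>'" "path_rng \<Gamma> \<alpha>' = path_rng \<Gamma> \<alpha>"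
    "ssrc \<Gamma> (hd \<alpha>') = ssrc \<Gamma> x"
    "linear_path \<Gamma> \<alpha>' \<Longrightarrow> linear_path \<Gamma> \<alpha> \<and> srng \<Gamma> x = ssrc \<Gamma> (hd \<alpha>)"
proof -
  obtain y \<rho> where \<alpha>_eq: "\<alpha> = y # \<rho>"
    using \<alpha> by (cases \<alpha>) (auto simp: reduced_path_def nonzero_path_def)
  have letters: "x \<in> nonzero_symbs \<Gamma>" "y \<in> nonzero_symbs \<Gamma>" "\<rho> \<in> lists (symbs \<Gamma>)"
    using x \<alpha> nonzero_path_words[of \<Gamma> \<alpha>]
    by (auto simp: \<alpha>_eq reduced_path_def nonzero_path_def nonempty_words_def)
  consider "x = VSet (ssrc \<Gamma> y)" | "x \<noteq> VSet (ssrc \<Gamma> y)" "y = VSet (srng \<Gamma> x)"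
    | "x \<noteq> VSet (ssrc \<Gamma> y)" "y \<noteq> VSet (srng \<Gamma> x)" by blast
  then show ?thesis
  proof cases
    case 1
    with letters have "x # \<alpha> \<approx>\<^bsub>\<Gamma>\<^esub> \<alpha>"
      using cong_NR_front[OF NR1_src, of y \<Gamma> \<rho>] by (simp add: \<alpha>_eq)
    with 1 \<alpha> show ?thesis
      by (intro that[of \<alpha>]) (auto simp: \<alpha>_eq)
  next
    case 2
    with letters have "x # \<alpha> \<approx>\<^bsub>\<Gamma>\<^esub> x # \<rho>"
      using cong_NR_front[OF NR1_rng, of x \<Gamma> \<rho>] by (simp add: \<alpha>_eq)
    moreover have "reduced_path \<Gamma> (x # \<rho>)"
      using 2 \<alpha> x by (cases \<rho>) (auto simp: \<alpha>_eq reduced_path_def nonzero_path_def)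
    moreover have "path_rng \<Gamma> (x # \<rho>) = path_rng \<Gamma> \<alpha>"
      using 2 by (simp add: \<alpha>_eq path_rng_def)
    moreover have "linear_path \<Gamma> \<alpha>" if "linear_path \<Gamma> (x # \<rho>)"
      using that 2 \<alpha> by (cases \<rho>) (auto simp: \<alpha>_eq linear_path_def reduced_path_def)
    ultimately show ?thesis
      using 2 by (intro that[of "x # \<rho>"]) (auto simp: \<alpha>_eq)
  next
    case 3
    have "x # \<alpha> \<approx>\<^bsub>\<Gamma>\<^esub> x # \<alpha>"
      using letters by (intro pres_cong.refl) (auto simp: \<alpha>_eq nonempty_words_def nonzero_symbs_imp_symbs)
    moreover have "reduced_path \<Gamma> (x # \<alpha>)"
      using 3 \<alpha> x meet by (auto simp: \<alpha>_eq reduced_path_def nonzero_path_def)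
    ultimately show ?thesis
      using \<alpha> by (intro that[of "x # \<alpha>"])
        (auto simp: \<alpha>_eq path_rng_def linear_path_def reduced_path_def)
  qed
qed

text \<open>
  In a reduced linear path a vertex set can only be the whole path; it makes way for \<open>t\<close>.
\<close>

lemma RLP_snoc:
  assumes \<beta>: "reduced_path \<Gamma> \<beta>" "linear_path \<Gamma> \<beta>" and t: "t \<in> rels \<Gamma>" "path_rng \<Gamma> \<beta> = src \<Gamma> t"
    and net: "network \<Gamma>"
  obtains \<beta>' where "reduced_path \<Gamma> \<beta>'" "linear_path \<Gamma> \<beta>'" "path_rng \<Gamma> \<beta>' = rng \<Gamma> t"
    "InvRel t # path_inv \<beta> \<approx>\<^bsub>\<Gamma>\<^esub> path_inv \<beta>'"
proof -
  obtain \<rho> y where \<beta>_eq: "\<beta> = \<rho> @ [y]"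
    using \<beta> by (cases \<beta> rule: rev_cases) (auto simp: reduced_path_def nonzero_path_def)
  have y: "y \<in> Rel ` rels \<Gamma> \<union> VSet ` vsets \<Gamma>" "srng \<Gamma> y = src \<Gamma> t"
    using \<beta> t by (auto simp: \<beta>_eq path_rng_def reduced_path_def nonzero_path_def)
  have ne: "src \<Gamma> t \<noteq> {}"
    using net t by (auto simp: network_def)
  show ?thesis
  proof (cases "y = VSet (src \<Gamma> t)")
    case True
    with \<beta> have "\<rho> = []"
      by (cases \<rho> rule: rev_cases)
        (auto simp: \<beta>_eq reduced_path_def linear_path_def successively_append_iff)
    then have "InvRel t # path_inv \<beta> \<approx>\<^bsub>\<Gamma>\<^esub> path_inv [Rel t]"
      using True t cong_NR_front[OF NR1_rng, of "InvRel t" \<Gamma> "[]"]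
      by (simp add: \<beta>_eq path_inv_def)
    then show ?thesis
      using t by (intro that[of "[Rel t]"])
        (auto simp: reduced_path_def linear_path_def nonzero_path_def path_rng_def)
  next
    case False
    have "InvRel t # path_inv \<beta> \<approx>\<^bsub>\<Gamma>\<^esub> path_inv (\<beta> @ [Rel t])"
      using path_inv_words[of \<Gamma> \<beta>] \<beta> t
      by (auto intro!: pres_cong.refl simp: path_inv_def nonempty_words_def reduced_path_def)
    then show ?thesis
      using \<beta> t y ne False by (intro that[of "\<beta> @ [Rel t]"])
        (auto simp: \<beta>_eq reduced_path_def linear_path_def nonzero_path_def path_rng_def
          successively_append_iff)
  qed
qed

text \<open>
  The one letter that could remove a break is \<open>t\<^sup>-\<^sup>1\<close>.  It cancels a leading \<open>t\<close>, after which the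
  set \<open>\<r>(t)\<close> still records the junction that \<open>t\<close> had with the next letter; when the path starts with
  a vertex set followed by a break, \<open>t\<^sup>-\<^sup>1\<close> meets the letter behind the break and gives \<open>0\<close>.
\<close>

lemma normal_form_Cons:
  assumes net: "network \<Gamma>" and nf: "right_normal_form \<Gamma> \<alpha> \<beta>" and x: "x \<in> nonzero_symbs \<Gamma>"
  shows "x # \<alpha> @ path_inv \<beta> \<approx>\<^bsub>\<Gamma>\<^esub> [Zero] \<or>
    (\<exists>\<alpha>' \<beta>'. right_normal_form \<Gamma> \<alpha>' \<beta>' \<and> x # \<alpha> @ path_inv \<beta> \<approx>\<^bsub>\<Gamma>\<^esub> \<alpha>' @ path_inv \<beta>' \<and>
       ssrc \<Gamma> (hd \<alpha>') = ssrc \<Gamma> x \<and>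
       (linear_path \<Gamma> \<alpha>' \<longrightarrow> linear_path \<Gamma> \<alpha> \<and> srng \<Gamma> x = ssrc \<Gamma> (hd \<alpha>)))"
    (is "?zero \<or> ?nf")
proof -
  have \<alpha>: "reduced_path \<Gamma> \<alpha>" and \<beta>: "reduced_path \<Gamma> \<beta>" "linear_path \<Gamma> \<beta>"
    and rng: "path_rng \<Gamma> \<alpha> = path_rng \<Gamma> \<beta>"
    using nf by (auto simp: right_normal_form_def)
  have inv\<beta>: "path_inv \<beta> \<in> lists (symbs \<Gamma>)"
    using \<beta> by (simp add: reduced_path_def path_inv_words)
  obtain y \<rho> where \<alpha>_eq: "\<alpha> = y # \<rho>"
    using \<alpha> by (cases \<alpha>) (auto simp: reduced_path_def nonzero_path_def)
  have \<rho>: "\<rho> \<in> lists (symbs \<Gamma>)" and y: "y \<in> Rel ` rels \<Gamma> \<union> VSet ` vsets \<Gamma>"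
    using \<alpha> nonzero_path_words[of \<Gamma> \<alpha>]
    by (auto simp: \<alpha>_eq reduced_path_def nonzero_path_def nonempty_words_def)
  have y_symb: "y \<in> nonzero_symbs \<Gamma>"
    using y by auto
  have rest: "\<rho> @ path_inv \<beta> \<in> lists (symbs \<Gamma>)"
    using \<rho> inv\<beta> by simp
  have zero: ?zero if "([x, y], [Zero]) \<in> NR \<Gamma>"
    using cong_Zero_front[OF that rest] by (simp add: \<alpha>_eq)
  show ?thesis
    using x
  proof (cases rule: nonzero_symbs_cases)
    case positive
    show ?thesis
    proof (cases "srng \<Gamma> x \<inter> ssrc \<Gamma> (hd \<alpha>) = {}")
      case True
      then show ?thesis
        using zero NR2[OF x y_symb] by (simp add: \<alpha>_eq)
    next
      case False
      then obtain \<alpha>' where \<alpha>': "reduced_path \<Gamma> \<alpha>'" "x # \<alpha> \<approx>\<^bsub>\<Gamma>\<^esub> \<alpha>'"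
        "path_rng \<Gamma> \<alpha>' = path_rng \<Gamma> \<alpha>" "ssrc \<Gamma> (hd \<alpha>') = ssrc \<Gamma> x"
        "linear_path \<Gamma> \<alpha>' \<Longrightarrow> linear_path \<Gamma> \<alpha> \<and> srng \<Gamma> x = ssrc \<Gamma> (hd \<alpha>)"
        using reduced_path_Cons[OF \<alpha> positive] by blast
      then have "x # \<alpha> @ path_inv \<beta> \<approx>\<^bsub>\<Gamma>\<^esub> \<alpha>' @ path_inv \<beta>"
        using pres_cong_context[OF \<alpha>'(2) _ inv\<beta>, of "[]"] by simp
      then show ?thesis
        using \<alpha>' \<beta> rng by (auto simp: right_normal_form_def)
    qed
  next
    case (inverse t)
    have vertex_nf: "right_normal_form \<Gamma> [VSet (rng \<Gamma> t)] \<delta>"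
      if "reduced_path \<Gamma> \<delta>" "linear_path \<Gamma> \<delta>" "path_rng \<Gamma> \<delta> = rng \<Gamma> t" for \<delta>
      using that inverse
      by (auto simp: right_normal_form_def reduced_path_def linear_path_def nonzero_path_def path_rng_def)
    consider (cancel) "y = Rel t" | (stop) "y = VSet (src \<Gamma> t)" "\<rho> = []"
      | (break) z \<sigma> where "y = VSet (src \<Gamma> t)" "\<rho> = z # \<sigma>"
      | (clash) "y \<noteq> Rel t" "y \<noteq> VSet (src \<Gamma> t)"
      by (cases \<rho>) auto
    then show ?thesis
    proof cases
      case cancel
      have cong: "x # \<alpha> @ path_inv \<beta> \<approx>\<^bsub>\<Gamma>\<^esub> VSet (rng \<Gamma> t) # \<rho> @ path_inv \<beta>"
        using cong_NR_front[OF NR4 rest, of t] inverse by (simp add: \<alpha>_eq cancel)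
      show ?thesis
      proof (cases "\<rho> = []")
        case True
        then have "right_normal_form \<Gamma> [VSet (rng \<Gamma> t)] \<beta>"
          using \<beta> rng by (intro vertex_nf) (auto simp: \<alpha>_eq cancel path_rng_def)
        moreover have "linear_path \<Gamma> \<alpha>"
          using \<alpha> True by (simp add: \<alpha>_eq linear_path_def reduced_path_def)
        ultimately show ?thesis
          using cong True inverse
          by (intro disjI2 exI[of _ "[VSet (rng \<Gamma> t)]"] exI[of _ \<beta>]) (auto simp: \<alpha>_eq cancel)
      next
        case False
        then obtain z \<sigma> where \<rho>_eq: "\<rho> = z # \<sigma>"
          by (cases \<rho>) auto
        have \<rho>_red: "reduced_path \<Gamma> \<rho>" and meet: "srng \<Gamma> (VSet (rng \<Gamma> t)) \<inter> ssrc \<Gamma> (hd \<rho>) \<noteq> {}"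
          using \<alpha> by (auto simp: \<alpha>_eq \<rho>_eq cancel reduced_path_def nonzero_path_def)
        have r: "VSet (rng \<Gamma> t) \<in> Rel ` rels \<Gamma> \<union> VSet ` vsets \<Gamma>"
          using inverse by simp
        obtain \<alpha>' where \<alpha>': "reduced_path \<Gamma> \<alpha>'" "VSet (rng \<Gamma> t) # \<rho> \<approx>\<^bsub>\<Gamma>\<^esub> \<alpha>'"
          "path_rng \<Gamma> \<alpha>' = path_rng \<Gamma> \<rho>" "ssrc \<Gamma> (hd \<alpha>') = rng \<Gamma> t"
          "linear_path \<Gamma> \<alpha>' \<Longrightarrow> linear_path \<Gamma> \<rho> \<and> rng \<Gamma> t = ssrc \<Gamma> (hd \<rho>)"
          using reduced_path_Cons[OF \<rho>_red r meet, unfolded ssrc.simps srng.simps] by blast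
        note cong
        also have "VSet (rng \<Gamma> t) # \<rho> @ path_inv \<beta> \<approx>\<^bsub>\<Gamma>\<^esub> \<alpha>' @ path_inv \<beta>"
          using pres_cong_context[OF \<alpha>'(2) _ inv\<beta>, of "[]"] by simp
        finally have "x # \<alpha> @ path_inv \<beta> \<approx>\<^bsub>\<Gamma>\<^esub> \<alpha>' @ path_inv \<beta>" .
        moreover have "right_normal_form \<Gamma> \<alpha>' \<beta>"
          using \<alpha>' \<beta> rng by (simp add: right_normal_form_def \<alpha>_eq \<rho>_eq path_rng_def)
        moreover have "linear_path \<Gamma> \<alpha>" if "linear_path \<Gamma> \<alpha>'"
          using \<alpha>'(5)[OF that] \<alpha> by (auto simp: \<alpha>_eq \<rho>_eq cancel linear_path_def reduced_path_def)
        ultimately show ?thesis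
          using \<alpha>'(4) inverse by (intro disjI2 exI[of _ \<alpha>'] exI[of _ \<beta>]) (auto simp: \<alpha>_eq cancel)
      qed
    next
      case stop
      then have "path_rng \<Gamma> \<beta> = src \<Gamma> t"
        using rng by (simp add: \<alpha>_eq path_rng_def)
      then obtain \<beta>' where \<beta>': "reduced_path \<Gamma> \<beta>'" "linear_path \<Gamma> \<beta>'" "path_rng \<Gamma> \<beta>' = rng \<Gamma> t"
        "InvRel t # path_inv \<beta> \<approx>\<^bsub>\<Gamma>\<^esub> path_inv \<beta>'"
        using RLP_snoc[OF \<beta> _ _ net] inverse by blast
      have nf': "right_normal_form \<Gamma> [VSet (rng \<Gamma> t)] \<beta>'"
        using \<beta>' by (intro vertex_nf)
      have "x # \<alpha> @ path_inv \<beta> \<approx>\<^bsub>\<Gamma>\<^esub> InvRel t # path_inv \<beta>"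
        using cong_NR_front[OF NR1_rng inv\<beta>, of "InvRel t"] inverse by (simp add: \<alpha>_eq stop)
      also have "InvRel t # path_inv \<beta> \<approx>\<^bsub>\<Gamma>\<^esub> VSet (rng \<Gamma> t) # InvRel t # path_inv \<beta>"
        using pres_cong.sym[OF cong_NR_front[OF NR1_src inv\<beta>, of "InvRel t"]] inverse by simp
      also have "VSet (rng \<Gamma> t) # InvRel t # path_inv \<beta> \<approx>\<^bsub>\<Gamma>\<^esub> VSet (rng \<Gamma> t) # path_inv \<beta>'"
        using pres_cong_context[OF \<beta>'(4), of "[VSet (rng \<Gamma> t)]" "[]"] inverse by simp
      finally have "x # \<alpha> @ path_inv \<beta> \<approx>\<^bsub>\<Gamma>\<^esub> [VSet (rng \<Gamma> t)] @ path_inv \<beta>'"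
        by simp
      moreover have "linear_path \<Gamma> \<alpha>"
        using \<alpha> stop by (simp add: \<alpha>_eq linear_path_def reduced_path_def)
      ultimately show ?thesis
        using nf' inverse by (intro disjI2 exI[of _ "[VSet (rng \<Gamma> t)]"] exI[of _ \<beta>'])
          (auto simp: \<alpha>_eq stop)
    next
      case break
      have z: "z \<in> Rel ` rels \<Gamma> \<union> VSet ` vsets \<Gamma>" "ssrc \<Gamma> z \<noteq> src \<Gamma> t"
        and \<sigma>: "\<sigma> @ path_inv \<beta> \<in> lists (symbs \<Gamma>)"
        using \<alpha> rest by (auto simp: \<alpha>_eq break reduced_path_def nonzero_path_def)
      have "x # \<alpha> @ path_inv \<beta> \<approx>\<^bsub>\<Gamma>\<^esub> InvRel t # z # \<sigma> @ path_inv \<beta>"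
        using cong_NR_front[OF NR1_rng rest, of "InvRel t"] inverse by (simp add: \<alpha>_eq break)
      also have "([InvRel t, z], [Zero]) \<in> NR \<Gamma>"
        using z inverse by (auto intro: NR3 NR5)
      from cong_Zero_front[OF this \<sigma>]
      have "InvRel t # z # \<sigma> @ path_inv \<beta> \<approx>\<^bsub>\<Gamma>\<^esub> [Zero]" by simp
      finally show ?thesis ..
    next
      case clash
      then have "([x, y], [Zero]) \<in> NR \<Gamma>"
        using y inverse by (auto intro: NR3 NR5)
      then show ?thesis
        using zero by blast
    qed
  qed
qed

text \<open>
  The source is carried along because a new break in front of the word must be recognised as a
  break in front of the path.
\<close>

lemma normal_form:
  assumes net: "network \<Gamma>" and "w \<noteq> []" "w \<in> lists (symbs \<Gamma>)"
  shows "w \<approx>\<^bsub>\<Gamma>\<^esub> [Zero] \<or>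
    (\<exists>\<alpha> \<beta>. right_normal_form \<Gamma> \<alpha> \<beta> \<and> w \<approx>\<^bsub>\<Gamma>\<^esub> \<alpha> @ path_inv \<beta> \<and>
       ssrc \<Gamma> (hd \<alpha>) = ssrc \<Gamma> (hd w) \<and> (linear_path \<Gamma> \<alpha> \<longrightarrow> \<not> broken \<Gamma> w))"
  using assms(2,3)
proof (induction w rule: list_nonempty_induct)
  case (single x)
  show ?case
  proof (cases "x = Zero")
    case True
    then show ?thesis by (simp add: pres_cong.refl nonempty_words_def)
  next
    case False
    with single have x: "x \<in> nonzero_symbs \<Gamma>"
      by (auto simp: symbs_def)
    \<comment> \<open>A letter is the product of itself with its range, which is already in normal form.\<close>
    let ?r = "[VSet (srng \<Gamma> x)]"
    have "VSet (srng \<Gamma> x) \<in> Rel ` rels \<Gamma> \<union> VSet ` vsets \<Gamma>"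
      using nonzero_symbs_src_rng[OF x] by simp
    then have nf: "right_normal_form \<Gamma> ?r ?r"
      by (auto simp: right_normal_form_def reduced_path_def linear_path_def nonzero_path_def)
    have "[x] \<approx>\<^bsub>\<Gamma>\<^esub> [x] @ ?r"
      using pres_cong.sym[OF cong_NR_front[OF NR1_rng[OF x], of "[]"]] by simp
    also have "[x] @ ?r \<approx>\<^bsub>\<Gamma>\<^esub> x # ?r @ path_inv ?r"
      using pres_cong.sym[OF cong_NR[OF NR1_rng, of "VSet (srng \<Gamma> x)" \<Gamma> "[x]" "[]"]]
        x nonzero_symbs_src_rng[OF x] by (simp add: path_inv_def nonzero_symbs_imp_symbs)
    finally have eq: "[x] \<approx>\<^bsub>\<Gamma>\<^esub> x # ?r @ path_inv ?r" .
    have "\<not> broken \<Gamma> [x]"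
      using False by (simp add: broken_def)
    then show ?thesis
      using normal_form_Cons[OF net nf x] cong_trans[OF eq] by fastforce
  qed
next
  case (cons x w)
  then have x: "x \<in> symbs \<Gamma>" and w: "w \<in> lists (symbs \<Gamma>)"
    by auto
  have ctx: "x # w \<approx>\<^bsub>\<Gamma>\<^esub> x # v" if "w \<approx>\<^bsub>\<Gamma>\<^esub> v" for v
    using pres_cong_context[OF that, of "[x]" "[]"] x by simp
  consider "x = Zero" | "x \<in> nonzero_symbs \<Gamma>" "w \<approx>\<^bsub>\<Gamma>\<^esub> [Zero]"
    | (nf) \<alpha> \<beta> where "x \<in> nonzero_symbs \<Gamma>" "right_normal_form \<Gamma> \<alpha> \<beta>"
      "w \<approx>\<^bsub>\<Gamma>\<^esub> \<alpha> @ path_inv \<beta>" "ssrc \<Gamma> (hd \<alpha>) = ssrc \<Gamma> (hd w)"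
      "linear_path \<Gamma> \<alpha> \<longrightarrow> \<not> broken \<Gamma> w"
    using cons.IH[OF w] x by (auto simp: symbs_def)
  then show ?case
  proof cases
    case 1
    then show ?thesis using Zero_absorbs_right[OF w] by simp
  next
    case 2
    have "[x] @ [Zero] \<approx>\<^bsub>\<Gamma>\<^esub> [Zero]"
      using x by (intro Zero_absorbs_left) simp
    with ctx[OF 2(2)] show ?thesis
      by (auto intro: cong_trans)
  next
    case nf
    have "\<not> broken \<Gamma> (x # w)" if "\<not> broken \<Gamma> w" "srng \<Gamma> x = ssrc \<Gamma> (hd w)"
      using that nf(1) cons.hyps by (auto simp: broken_def successively_Cons)
    then show ?thesis
      using normal_form_Cons[OF net nf(2,1)] cong_trans[OF ctx[OF nf(3)]] nf(4,5)
      by (metis list.sel(1))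
  qed
qed

section \<open>An action that counts breaks\<close>

text \<open>
  The triple \<open>(C, u, n)\<close> stands for a path with source \<open>C\<close> that runs linearly through the relations
  \<open>u\<close> and has \<open>n\<close> breaks; what follows the first break is forgotten.  It behaves well under left
  multiplication because \<open>t\<^sup>-\<^sup>1\<close> cancels only into the linear initial segment.  \<open>None\<close> is the zero.
\<close>

fun act :: "('v, 't) network_data \<Rightarrow> ('v, 't) symb \<Rightarrow>
    ('v set \<times> 't list \<times> nat) option \<Rightarrow> ('v set \<times> 't list \<times> nat) option" where
  "act \<Gamma> x None = None"
| "act \<Gamma> Zero (Some s) = None"
| "act \<Gamma> (Rel t) (Some (C, u, n)) =
    (if C = rng \<Gamma> t then Some (src \<Gamma> t, t # u, n)
     else if rng \<Gamma> t \<inter> C \<noteq> {} then Some (src \<Gamma> t, [t], Suc n) else None)"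
| "act \<Gamma> (VSet A) (Some (C, u, n)) =
    (if C = A then Some (C, u, n)
     else if A \<inter> C \<noteq> {} then Some (A, [], Suc n) else None)"
| "act \<Gamma> (InvRel t) (Some (C, u, n)) =
    (if C = src \<Gamma> t \<and> u \<noteq> [] \<and> hd u = t then Some (rng \<Gamma> t, tl u, n) else None)"

lemma act_Zero [simp]: "act \<Gamma> Zero s = None"
  by (cases s) auto

definition act_word :: "('v, 't) network_data \<Rightarrow> ('v, 't) symb list \<Rightarrow>
    ('v set \<times> 't list \<times> nat) option \<Rightarrow> ('v set \<times> 't list \<times> nat) option" where
  "act_word \<Gamma> w s = foldr (act \<Gamma>) w s"

lemma act_word_simps [simp]:
  "act_word \<Gamma> [] s = s"
  "act_word \<Gamma> (x # w) s = act \<Gamma> x (act_word \<Gamma> w s)"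
  "act_word \<Gamma> (v @ w) s = act_word \<Gamma> v (act_word \<Gamma> w s)"
  by (simp_all add: act_word_def)

lemma act_source_and_breaks:
  assumes "act \<Gamma> x (Some (C, u, n)) = Some (C', u', n')"
  shows "C' = ssrc \<Gamma> x" "n \<le> n'" "C \<noteq> srng \<Gamma> x \<Longrightarrow> n < n'"
  using assms by (cases x; auto split: if_splits)+

lemma act_word_None [simp]: "act_word \<Gamma> w None = None"
  by (induction w) auto

lemma act_respects_NR:
  assumes net: "network \<Gamma>" and "(u, v) \<in> NR \<Gamma>"
  shows "act_word \<Gamma> u s = act_word \<Gamma> v s"
proof (cases s)
  case (Some p)
  obtain C w n where p: "p = (C, w, n)"
    by (cases p)
  have ne: "src \<Gamma> t \<noteq> {}" "rng \<Gamma> t \<noteq> {}" if "t \<in> rels \<Gamma>" for t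
    using net that by (auto simp: network_def)
  have ne': "A \<noteq> {}" if "A \<in> vsets \<Gamma>" for A
    using that ne by (auto simp: vsets_def)
  from assms(2) have "act_word \<Gamma> u (Some (C, w, n)) = act_word \<Gamma> v (Some (C, w, n))"
  proof cases
    case (NR2 x y)
    \<comment> \<open>The letter \<open>y\<close> leaves a triple with source \<open>\<s>(y)\<close>, which is non-empty, so it differs from \<open>\<r>(x)\<close>.\<close>
    then show ?thesis
      using ne ne' by (auto simp: nonzero_symbs_def split: if_splits)
  qed (auto simp: nonzero_symbs_def symbs_def split: if_splits)
  then show ?thesis
    by (simp add: Some p)
qed simp

lemma act_respects_cong:
  assumes "network \<Gamma>" and "u \<approx>\<^bsub>\<Gamma>\<^esub> v"
  shows "act_word \<Gamma> u s = act_word \<Gamma> v s"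
  using assms(2)
  by (induction arbitrary: s) (auto simp: act_respects_NR[OF assms(1)])

lemma act_word_source:
  assumes "act_word \<Gamma> w s = Some (C, u, n)" "w \<noteq> []"
  shows "C = ssrc \<Gamma> (hd w)"
proof -
  obtain x v where w: "w = x # v"
    using assms(2) by (cases w) auto
  obtain D u' n' where "act_word \<Gamma> v s = Some (D, u', n')"
    using assms(1) by (cases "act_word \<Gamma> v s") (auto simp: w)
  with assms(1) show ?thesis
    using act_source_and_breaks(1) by (fastforce simp: w)
qed

text \<open>
  A letter that does not annihilate a triple either continues it linearly or breaks it.  For
  \<open>t\<^sup>-\<^sup>1\<close> only the former occurs.
\<close>

lemma broken_raises:
  assumes "act_word \<Gamma> w (Some (C, u, n)) = Some (C', u', n')"
  shows "n \<le> n'" "broken \<Gamma> w \<Longrightarrow> n < n'"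
proof -
  have "n \<le> n' \<and> (broken \<Gamma> w \<longrightarrow> n < n')"
    using assms
  proof (induction w arbitrary: C' u' n')
    case Nil
    then show ?case by (simp add: broken_def)
  next
    case (Cons x w)
    then obtain D v m where mid: "act_word \<Gamma> w (Some (C, u, n)) = Some (D, v, m)"
      and last: "act \<Gamma> x (Some (D, v, m)) = Some (C', u', n')"
      by (cases "act_word \<Gamma> w (Some (C, u, n))") auto
    have "x \<noteq> Zero"
      using last by auto
    then have "broken \<Gamma> w \<or> D \<noteq> srng \<Gamma> x" if "broken \<Gamma> (x # w)"
      using that act_word_source[OF mid] by (auto simp: broken_def successively_Cons)
    then show ?case
      using Cons.IH[OF mid] act_source_and_breaks(2,3)[OF last] by fastforce
  qed
  then show "n \<le> n'" "broken \<Gamma> w \<Longrightarrow> n < n'" by auto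
qed

lemma path_acts_nonzero:
  assumes "nonzero_path \<Gamma> \<alpha>"
  shows "act_word \<Gamma> \<alpha> (Some (path_rng \<Gamma> \<alpha>, u, n)) \<noteq> None"
proof -
  have "\<alpha> \<noteq> []" using assms by (simp add: nonzero_path_def)
  then show ?thesis
    using assms
  proof (induction \<alpha> rule: list_nonempty_induct)
    case (single x)
    then show ?case by (auto simp: nonzero_path_def path_rng_def)
  next
    case (cons x \<alpha>)
    then have x: "x \<in> Rel ` rels \<Gamma> \<union> VSet ` vsets \<Gamma>" "srng \<Gamma> x \<inter> ssrc \<Gamma> (hd \<alpha>) \<noteq> {}"
      and "nonzero_path \<Gamma> \<alpha>"
      by (auto simp: nonzero_path_def successively_Cons)
    with cons obtain C v m
      where "act_word \<Gamma> \<alpha> (Some (path_rng \<Gamma> \<alpha>, u, n)) = Some (C, v, m)"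
      by fastforce
    moreover from act_word_source[OF this cons.hyps] have "srng \<Gamma> x \<inter> C \<noteq> {}"
      using x by simp
    moreover have "path_rng \<Gamma> (x # \<alpha>) = path_rng \<Gamma> \<alpha>"
      using cons.hyps by (simp add: path_rng_def)
    ultimately show ?case
      using x(1) by (auto split: if_splits)
  qed
qed

text \<open>
  A linear path \<open>\<beta>\<close> is remembered completely by its triple, so that \<open>\<beta>\<^sup>-\<^sup>1\<close> can undo it.
\<close>

lemma path_inv_undoes_linear_path:
  assumes "linear_path \<Gamma> \<beta>"
  shows "act_word \<Gamma> (path_inv \<beta>) (act_word \<Gamma> \<beta> (Some (path_rng \<Gamma> \<beta>, u, n))) =
    Some (path_rng \<Gamma> \<beta>, u, n)"
proof -
  have "\<beta> \<noteq> []" using assms by (simp add: linear_path_def nonzero_path_def)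
  then show ?thesis
    using assms
  proof (induction \<beta> rule: list_nonempty_induct)
    case (single x)
    then show ?case by (auto simp: linear_path_def nonzero_path_def path_rng_def path_inv_def)
  next
    case (cons x \<beta>)
    then have x: "x \<in> Rel ` rels \<Gamma> \<union> VSet ` vsets \<Gamma>" "srng \<Gamma> x = ssrc \<Gamma> (hd \<beta>)"
      and \<beta>: "linear_path \<Gamma> \<beta>"
      by (auto simp: linear_path_def nonzero_path_def successively_Cons)
    let ?s = "act_word \<Gamma> \<beta> (Some (path_rng \<Gamma> \<beta>, u, n))"
    obtain C v m where s: "?s = Some (C, v, m)"
      using path_acts_nonzero[of \<Gamma> \<beta> u n] \<beta> by (auto simp: linear_path_def)
    with act_word_source[OF s cons.hyps] have "act \<Gamma> (sinv x) (act \<Gamma> x ?s) = ?s"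
      using x by auto
    moreover have "path_rng \<Gamma> (x # \<beta>) = path_rng \<Gamma> \<beta>"
      using cons.hyps by (simp add: path_rng_def)
    ultimately show ?case
      using cons.IH[OF \<beta>] by (simp add: path_inv_def)
  qed
qed

lemma right_normal_form_acts_nonzero:
  assumes "right_normal_form \<Gamma> \<alpha> \<beta>"
  obtains s where "act_word \<Gamma> (\<alpha> @ path_inv \<beta>) s \<noteq> None"
proof
  show "act_word \<Gamma> (\<alpha> @ path_inv \<beta>)
      (act_word \<Gamma> \<beta> (Some (path_rng \<Gamma> \<beta>, [], 0))) \<noteq> None"
    using assms path_acts_nonzero[of \<Gamma> \<alpha> "[]" 0] path_inv_undoes_linear_path[of \<Gamma> \<beta> "[]" 0]
    by (simp add: right_normal_form_def reduced_path_def)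
qed

lemma broken_idempotent_annihilates:
  assumes "network \<Gamma>" "broken \<Gamma> w" "w @ w \<approx>\<^bsub>\<Gamma>\<^esub> w"
  shows "act_word \<Gamma> w s = None"
proof (rule ccontr)
  assume "act_word \<Gamma> w s \<noteq> None"
  then obtain C u n where "act_word \<Gamma> w s = Some (C, u, n)"
    by auto
  moreover from this have "act_word \<Gamma> w (Some (C, u, n)) = Some (C, u, n)"
    using act_respects_cong[OF assms(1,3), of s] by simp
  ultimately show False
    using broken_raises(2) assms(2) by blast
qed

section \<open>The ideal of broken words\<close>

text \<open>
  A non-linear \<open>\<alpha>\<close> is itself a broken word; conversely, passing to the normal form of a broken word
  either yields \<open>0\<close> or carries the break over to \<open>\<alpha>\<close>.
\<close>

lemma ideal_eq_broken_classes:
  assumes net: "network \<Gamma>"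
  shows "{Qclass \<Gamma> (\<alpha> @ path_inv \<beta>) | \<alpha> \<beta>. right_normal_form \<Gamma> \<alpha> \<beta> \<and> \<not> linear_path \<Gamma> \<alpha>}
      \<union> {Qclass \<Gamma> [Zero]} =
    Qclass \<Gamma> ` {w \<in> nonempty_words (symbs \<Gamma>). broken \<Gamma> w}" (is "?I \<union> ?O = ?J")
proof (intro equalityI subsetI)
  fix a assume "a \<in> ?I \<union> ?O"
  moreover have "[Zero] \<in> nonempty_words (symbs \<Gamma>)" "broken \<Gamma> [Zero]"
    by (auto simp: nonempty_words_def broken_def)
  ultimately show "a \<in> ?J"
    using right_normal_form_words right_normal_form_broken by blast
next
  fix a assume "a \<in> ?J"
  then obtain w where w: "w \<in> nonempty_words (symbs \<Gamma>)" "broken \<Gamma> w" and a: "a = Qclass \<Gamma> w"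
    by auto
  have eq: "a = Qclass \<Gamma> v" if "w \<approx>\<^bsub>\<Gamma>\<^esub> v" for v
    using that by (simp add: a Qclass_def pres_class_def equiv_class_eq[OF equiv_pres_cong])
  show "a \<in> ?I \<union> ?O"
    using normal_form[OF net, of w] w eq by (auto simp: nonempty_words_def)
qed

lemma broken_classes_ideal:
  "semigroup_ideal (Q \<Gamma>) (Qmult \<Gamma>) (Qclass \<Gamma> ` {w \<in> nonempty_words (symbs \<Gamma>). broken \<Gamma> w})"
proof -
  have "[Zero] \<in> nonempty_words (symbs \<Gamma>)" "broken \<Gamma> [Zero]"
    by (auto simp: nonempty_words_def broken_def)
  moreover have "u @ v \<in> nonempty_words (symbs \<Gamma>)"
    if "u \<in> nonempty_words (symbs \<Gamma>)" "v \<in> nonempty_words (symbs \<Gamma>)" for u v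
    using that by (auto simp: nonempty_words_def)
  ultimately show ?thesis
    unfolding semigroup_ideal_def Q_eq_classes
    by (auto simp: Qmult_class intro!: imageI broken_append)
qed

lemma vertex_not_broken_class:
  assumes "network \<Gamma>" "v \<in> verts \<Gamma>" "w \<in> nonempty_words (symbs \<Gamma>)" "broken \<Gamma> w"
  shows "Qclass \<Gamma> [VSet {v}] \<noteq> Qclass \<Gamma> w"
proof
  assume "Qclass \<Gamma> [VSet {v}] = Qclass \<Gamma> w"
  moreover have "[VSet {v}] \<in> nonempty_words (symbs \<Gamma>)"
    using assms(2) by (auto simp: nonempty_words_def vsets_def)
  ultimately have "[VSet {v}] \<approx>\<^bsub>\<Gamma>\<^esub> w"
    using assms(3) by (simp add: Qclass_eq_iff)
  from act_respects_cong[OF assms(1) this, of "Some ({v}, [], 0)"]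
  have "act_word \<Gamma> w (Some ({v}, [], 0)) = Some ({v}, [], 0)"
    by simp
  from broken_raises(2)[OF this assms(4)] show False by simp
qed

theorem lemma4p1:
  fixes \<Gamma> :: "('v, 't) network_data"
    and I :: "('v, 't) symb list set set"
  assumes "network \<Gamma>" and "verts \<Gamma> \<noteq> {}"
    and "I = {Qclass \<Gamma> (\<alpha> @ path_inv \<beta>) | \<alpha> \<beta>.
               \<alpha> \<in> RP \<Gamma> - RLP \<Gamma> \<and> \<alpha> \<noteq> [Zero] \<and> \<beta> \<in> RLP \<Gamma> \<and>
               path_rng \<Gamma> \<alpha> = path_rng \<Gamma> \<beta>} \<union> {Qclass \<Gamma> [Zero]}"
  shows "proper_semigroup_ideal (Q \<Gamma>) (Qmult \<Gamma>) I \<and>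
    semigroup_congruence (Q \<Gamma>) (Qmult \<Gamma>) (I \<times> I \<union> Id_on (Q \<Gamma>)) \<and>
    idempotent_separating (Q \<Gamma>) (Qmult \<Gamma>) (I \<times> I \<union> Id_on (Q \<Gamma>))"
proof -
  let ?J = "Qclass \<Gamma> ` {w \<in> nonempty_words (symbs \<Gamma>). broken \<Gamma> w}"
  have "\<not> reduced_path \<Gamma> [Zero]"
    by (auto simp: reduced_path_def nonzero_path_def)
  then have "\<alpha> \<in> RP \<Gamma> - RLP \<Gamma> \<and> \<alpha> \<noteq> [Zero] \<and> \<beta> \<in> RLP \<Gamma> \<and> path_rng \<Gamma> \<alpha> = path_rng \<Gamma> \<beta> \<longleftrightarrow>
      right_normal_form \<Gamma> \<alpha> \<beta> \<and> \<not> linear_path \<Gamma> \<alpha>" for \<alpha> \<beta>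
    by (auto simp: RP_def RLP_def right_normal_form_def)
  then have I: "I = {Qclass \<Gamma> (\<alpha> @ path_inv \<beta>) | \<alpha> \<beta>.
      right_normal_form \<Gamma> \<alpha> \<beta> \<and> \<not> linear_path \<Gamma> \<alpha>} \<union> {Qclass \<Gamma> [Zero]}"
    unfolding assms(3) by simp
  have IJ: "I = ?J"
    unfolding I by (rule ideal_eq_broken_classes[OF assms(1)])
  have ideal: "semigroup_ideal (Q \<Gamma>) (Qmult \<Gamma>) I"
    unfolding IJ by (rule broken_classes_ideal)
  have proper: "I \<noteq> Q \<Gamma>"
  proof -
    obtain v where v: "v \<in> verts \<Gamma>"
      using assms(2) by auto
    then have "Qclass \<Gamma> [VSet {v}] \<in> Q \<Gamma>"
      unfolding Q_eq_classes by (intro imageI) (auto simp: nonempty_words_def vsets_def)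
    moreover have "Qclass \<Gamma> [VSet {v}] \<notin> I"
      unfolding IJ using vertex_not_broken_class[OF assms(1) v] by auto
    ultimately show ?thesis by blast
  qed
  have idem: "e = Qclass \<Gamma> [Zero]" if e: "e \<in> I" "Qmult \<Gamma> e e = e" for e
  proof (rule ccontr)
    assume "e \<noteq> Qclass \<Gamma> [Zero]"
    with e(1) obtain \<alpha> \<beta> where nf: "right_normal_form \<Gamma> \<alpha> \<beta>" and nl: "\<not> linear_path \<Gamma> \<alpha>"
      and e_eq: "e = Qclass \<Gamma> (\<alpha> @ path_inv \<beta>)"
      unfolding I by auto
    let ?w = "\<alpha> @ path_inv \<beta>"
    have w: "?w \<in> nonempty_words (symbs \<Gamma>)"
      by (rule right_normal_form_words[OF nf])
    then have "?w @ ?w \<in> nonempty_words (symbs \<Gamma>)"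
      by (auto simp: nonempty_words_def)
    with w e(2) have "?w @ ?w \<approx>\<^bsub>\<Gamma>\<^esub> ?w"
      unfolding e_eq Qmult_class[OF w w] by (simp only: Qclass_eq_iff)
    moreover have "broken \<Gamma> ?w"
      by (rule right_normal_form_broken[OF nf nl])
    ultimately have "act_word \<Gamma> ?w s = None" for s
      by (intro broken_idempotent_annihilates[OF assms(1)])
    then show False
      using right_normal_form_acts_nonzero[OF nf] by metis
  qed
  have "idempotent_separating (Q \<Gamma>) (Qmult \<Gamma>) (I \<times> I \<union> Id_on (Q \<Gamma>))"
    using idem by (auto simp: idempotent_separating_def)
  then show ?thesis
    using ideal proper Rees_congruence[OF semigroup_on_Q ideal]
    by (simp add: proper_semigroup_ideal_def)
qed

end
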